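(* Let $l_1,l_2,\alpha_1,\lambda\in\mathbb{C}$ and $t_1,t_2\in\mathbb{C}\setminus\{0\}$. Consider the $q$-difference equation (variant of the confluent $q$-hypergeometric equation of type $(2,0)$) $$q^{-2\lambda-1}(1-q^{-l_1+1/2}t_1^{-1}x)(1-q^{-l_2+1/2}t_2^{-1}x)g(qx)+g(x/q)$$ $$-\big[q^{-\alpha_1-l_1-l_2-2\lambda}t_1^{-1}t_2^{-1}x^2-q^{-\lambda-1/2}(q^{-l_1}t_1^{-1}+q^{-l_2}t_2^{-1})x+q^{-\lambda}(1+q^{-1})\big]g(x)=0.$$ (i) Let $(i,i')=(1,2)$ or $(2,1)$. Then $$x^\lambda\sum_{n=0}^\infty(-q^{-\lambda-\alpha_1+l_i-l_{i'}}t_i/t_{i'})^n\frac{q^{-n(n-1)/2}(q^{\lambda+\alpha_1};q)_n}{(q;q)_n}\Big(\frac{x}{q^{l_i-1/2}t_i};q\Big)_n$$ $$\Big(=x^\lambda\,{}_2\phi_0\Big(q^{\lambda+\alpha_1},\frac{x}{q^{l_i-1/2}t_i};-;q,q^{-\lambda-\alpha_1+l_i-l_{i'}}t_i/t_{i'}\Big)\Big)$$ is a formal solution of this equation. (ii) The function $$g(x)=x^{-\alpha_1}\sum_{n=0}^\infty(q^{1/2}x^{-1})^n(q^{\lambda+\alpha_1};q)_n\sum_{k=0}^n\frac{(q^{l_1}t_1)^k(q^{l_2}t_2)^{n-k}}{(q;q)_k(q;q)_{n-k}}$$ is a formal solution of this equation. (iii) Let $(i,i')=(1,2)$ or $(2,1)$.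 Then $$g(x)=x^{-\alpha_1}\sum_{n=0}^\infty c_n\Big(\frac{x}{q^{l_i-1/2}t_i};q\Big)_n\Big(-\frac{q^{-\lambda-\alpha_1+l_i}t_i}{x}\Big)^n(q^{\lambda+\alpha_1};q)_n\,q^{-n^2/2},$$ $$c_n=\sum_{k=0}^nq^{-nk}\frac{1}{(q;q)_{n-k}(q;q)_k}\Big(\frac{q^{-\lambda-\alpha_1+l_i-l_{i'}}t_i}{t_{i'}}\Big)^k$$ is a formal solution of this equation.
   Context: Conventions: $q\in\mathbb{C}\setminus\{0\}$ is not a root of unity, with a fixed choice of $\log q$, and $q^{a}=\exp(a\log q)$. $(\lambda;q)_n=\prod_{j=0}^{n-1}(1-\lambda q^j)$. The basic hypergeometric series is ${}_r\phi_s(a_1,\dots,a_r;b_1,\dots,b_s;q,z)=\sum_{n\ge0}\frac{(a_1;q)_n\cdots(a_r;q)_n}{(b_1;q)_n\cdots(b_s;q)_n(q;q)_n}\big[(-1)^nq^{n(n-1)/2}\big]^{1+s-r}z^n$ (a dash means no lower parameters). Formal solutions: convergence is not considered. For $\mu\in\mathbb{C}$, $x^\mu$ is a symbol with $(q^{\pm1}x)^\mu=q^{\pm\mu}x^\mu$. Each series has the form $x^\mu\sum_{n\ge0}a_n\varphi_n(x)$, where $a_n$ does not depend on $x$ and $\varphi_n$ (the $x$-dependent part of the $n$-th term) is a polynomial of degree $n$ in $x$ or a polynomial of degree $n$ in $1/x$ (here $\varphi_n=(x/(q^{l_i-1/2}t_i);q)_n$ in (i), $x^{-n}$ in (ii),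 $(x/(q^{l_i-1/2}t_i);q)_n\,x^{-n}$ in (iii)). It is a formal solution if, substituting termwise into the left-hand side, dividing by $x^\mu$ (and also by $x^2$ when the $\varphi_n$ are polynomials in $1/x$), and expanding each resulting term in the basis $(\varphi_m)_{m\ge0}$ (in the $1/x$ case, the basis of polynomials in $1/x$), the total coefficient of every $\varphi_m$ (a finite sum) is zero. If the series terminates this means it is an exact solution. *)

theory Defs
  imports Complex_Main "HOL-Computational_Algebra.Polynomial"
begin

text \<open>
  Throughout, \<open>w\<close> stands for the chosen logarithm of \<open>q\<close> (\<open>exp w = q\<close>), so that \<open>qpow w a\<close> is \<open>q\<^sup>a\<close>.
\<close>

definition qpow :: "complex \<Rightarrow> complex \<Rightarrow> complex" where
  "qpow w a = exp (a * w)"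

definition qpoch :: "complex \<Rightarrow> complex \<Rightarrow> nat \<Rightarrow> complex" where
  "qpoch a q n = (\<Prod>j<n. 1 - a * q ^ j)"

text \<open>
  The \<open>n\<close>-th term of the basic hypergeometric series with upper parameters \<open>as\<close> and lower
  parameters \<open>bs\<close>.  Only the terms are needed, since the series are treated formally.
\<close>

definition bhs_term ::
  "complex list \<Rightarrow> complex list \<Rightarrow> complex \<Rightarrow> complex \<Rightarrow> nat \<Rightarrow> complex" where
  "bhs_term as bs q z n =
     (\<Prod>a\<leftarrow>as. qpoch a q n) / ((\<Prod>b\<leftarrow>bs. qpoch b q n) * qpoch q q n)
     * ((-1) ^ n * q ^ (n * (n - 1) div 2)) powi (1 + int (length bs) - int (length as))
     * z ^ n"

text \<open>
  The left-hand side of the \<open>q\<close>-difference equation at \<open>x\<close>, where \<open>gp\<close>, \<open>gm\<close>, \<open>g0\<close> stand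
  for \<open>g (q x)\<close>, \<open>g (x / q)\<close>, \<open>g x\<close>.  Keeping these three apart makes it possible to
  substitute the formal expression \<open>x\<^sup>\<mu> h(x)\<close>.
\<close>

definition confl_lhs ::
  "complex \<Rightarrow> complex \<Rightarrow> (nat \<Rightarrow> complex) \<Rightarrow> complex \<Rightarrow> complex \<Rightarrow> (nat \<Rightarrow> complex)
    \<Rightarrow> complex \<Rightarrow> complex \<Rightarrow> complex \<Rightarrow> complex \<Rightarrow> complex" where
  "confl_lhs q w l \<alpha> lam t x gp gm g0 =
     qpow w (- 2 * lam - 1)
       * (1 - qpow w (- l 1 + 1/2) * inverse (t 1) * x)
       * (1 - qpow w (- l 2 + 1/2) * inverse (t 2) * x) * gp
     + gm
     - (qpow w (- \<alpha> - l 1 - l 2 - 2 * lam) * inverse (t 1) * inverse (t 2) * x ^ 2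
        - qpow w (- lam - 1/2)
            * (qpow w (- l 1) * inverse (t 1) + qpow w (- l 2) * inverse (t 2)) * x
        + qpow w (- lam) * (1 + inverse q)) * g0"

text \<open>
  \<open>\<phi> n\<close> is a polynomial of degree \<open>n\<close> in \<open>x\<close>, respectively in \<open>1 / x\<close>.  The condition
  \<open>p \<noteq> 0\<close> is needed because the zero polynomial has \<open>degree\<close> \<open>0\<close> in the library.
\<close>

definition polys_in_x :: "(nat \<Rightarrow> complex \<Rightarrow> complex) \<Rightarrow> bool" where
  "polys_in_x \<phi> \<longleftrightarrow> (\<forall>n. \<exists>p. p \<noteq> 0 \<and> degree p = n \<and> (\<forall>x. x \<noteq> 0 \<longrightarrow> \<phi> n x = poly p x))"

definition polys_in_inverse_x :: "(nat \<Rightarrow> complex \<Rightarrow> complex) \<Rightarrow> bool" where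
  "polys_in_inverse_x \<phi> \<longleftrightarrow>
     (\<forall>n. \<exists>p. p \<noteq> 0 \<and> degree p = n \<and> (\<forall>x. x \<noteq> 0 \<longrightarrow> \<phi> n x = poly p (1 / x)))"

text \<open>
  Each term \<open>T n\<close> is a finite linear combination of the \<open>\<phi> m\<close> (on \<open>x \<noteq> 0\<close>), with coefficient
  matrix \<open>e\<close>, and for each \<open>m\<close> the total coefficient of \<open>\<phi> m\<close> is a finite sum equal to zero.
  When \<open>\<phi>\<close> satisfies one of the two conditions above, it is linearly independent, so \<open>e\<close> is
  uniquely determined by \<open>T\<close>.
\<close>

definition coefficients_vanish ::
  "(nat \<Rightarrow> complex \<Rightarrow> complex) \<Rightarrow> (nat \<Rightarrow> complex \<Rightarrow> complex) \<Rightarrow> bool" where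
  "coefficients_vanish \<phi> T \<longleftrightarrow>
     (\<exists>e :: nat \<Rightarrow> nat \<Rightarrow> complex.
        (\<forall>n. finite {m. e n m \<noteq> 0} \<and>
             (\<forall>x. x \<noteq> 0 \<longrightarrow> T n x = (\<Sum>m | e n m \<noteq> 0. e n m * \<phi> m x))) \<and>
        (\<forall>m. finite {n. e n m \<noteq> 0} \<and> (\<Sum>n | e n m \<noteq> 0. e n m) = 0))"

text \<open>
  \<open>lhs_term q w E \<mu> h\<close> is the result of substituting \<open>x\<^sup>\<mu> h(x)\<close> into the left-hand side \<open>E\<close>
  and dividing by \<open>x\<^sup>\<mu>\<close>, using \<open>(q\<^sup>\<plusminus>\<^sup>1 x)\<^sup>\<mu> = q\<^sup>\<plusminus>\<^sup>\<mu> x\<^sup>\<mu>\<close>; here \<open>E x gp gm g0\<close> is, as for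
  \<open>confl_lhs\<close>, homogeneous linear in \<open>gp\<close>, \<open>gm\<close>, \<open>g0\<close>.
\<close>

definition lhs_term ::
  "complex \<Rightarrow> complex \<Rightarrow> (complex \<Rightarrow> complex \<Rightarrow> complex \<Rightarrow> complex \<Rightarrow> complex)
    \<Rightarrow> complex \<Rightarrow> (complex \<Rightarrow> complex) \<Rightarrow> complex \<Rightarrow> complex" where
  "lhs_term q w E \<mu> h x =
     E x (qpow w \<mu> * h (q * x)) (qpow w (- \<mu>) * h (x / q)) (h x)"

text \<open>
  \<open>x\<^sup>\<mu> \<Sum>\<^sub>n a\<^sub>n \<phi>\<^sub>n(x)\<close> is a formal solution of \<open>E = 0\<close>.  The two alternatives exclude each
  other, since \<open>\<phi> 1\<close> cannot be of degree one both in \<open>x\<close> and in \<open>1 / x\<close>.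
\<close>

definition formal_solution ::
  "complex \<Rightarrow> complex \<Rightarrow> (complex \<Rightarrow> complex \<Rightarrow> complex \<Rightarrow> complex \<Rightarrow> complex)
    \<Rightarrow> complex \<Rightarrow> (nat \<Rightarrow> complex) \<Rightarrow> (nat \<Rightarrow> complex \<Rightarrow> complex) \<Rightarrow> bool" where
  "formal_solution q w E \<mu> a \<phi> \<longleftrightarrow>
     polys_in_x \<phi> \<and>
       coefficients_vanish \<phi> (\<lambda>n. lhs_term q w E \<mu> (\<lambda>x. a n * \<phi> n x))
     \<or>
     polys_in_inverse_x \<phi> \<and>
       coefficients_vanish \<phi> (\<lambda>n x. lhs_term q w E \<mu> (\<lambda>x. a n * \<phi> n x) x / x ^ 2)"

end

theory Submission
  imports Defs "HOL-Computational_Algebra.Formal_Power_Series"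
begin

text \<open>
  Write \<open>s = q\<^bsup>l\<^sub>i - 1/2\<^esup> t\<^sub>i\<close>, \<open>r = q\<^bsup>l\<^sub>i\<^sub>' - 1/2\<^esup> t\<^sub>i\<^sub>'\<close>, \<open>L = q\<^sup>\<lambda>\<close>, \<open>A = q\<^sup>\<alpha>\<close>; then
  the equation is symmetric in \<open>s\<close> and \<open>r\<close>.  In all three cases the \<open>n\<close>-th term of the
  substituted series is, up to a constant \<open>K\<close>, a difference \<open>W\<^sub>n\<^sub>-\<^sub>1 - W\<^sub>n\<close> with
  \<open>W\<^sub>-\<^sub>1 = 0\<close> and \<open>W\<^sub>n\<close> in the span of \<open>\<phi>\<^sub>n, \<phi>\<^sub>n\<^sub>+\<^sub>1, \<phi>\<^sub>n\<^sub>+\<^sub>2\<close>, so the coefficients telescope.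
  For (i) this is the first-order recurrence of \<open>a\<^sub>n\<close>.  For (ii) and (iii) it is the three-term
  recurrence of the inner sums, which are Rogers-Szego polynomials (obtained from the product of two
  series \<open>f(z)\<close> with \<open>f(q z) = (1 - u z) f(z)\<close>) and Stieltjes-Wigert polynomials in base \<open>1/q\<close>.
\<close>

section \<open>Telescoping criterion for vanishing coefficients\<close>

lemma coefficients_vanish_telescope:
  assumes K: "K \<noteq> 0"
    and W: "\<And>n x. W n x = a n * \<phi> n x + b n * \<phi> (Suc n) x + c n * \<phi> (Suc (Suc n)) x"
    and T0: "\<And>x. x \<noteq> 0 \<Longrightarrow> K * T 0 x = - W 0 x"
    and TS: "\<And>n x. x \<noteq> 0 \<Longrightarrow> K * T (Suc n) x = W n x - W (Suc n) x"
  shows "coefficients_vanish \<phi> T"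
proof -
  define d where "d n m = (if m = n then a n else if m = Suc n then b n
    else if m = Suc (Suc n) then c n else 0)" for n m
  \<comment> \<open>\<open>d n\<close> lists the coefficients of \<open>W n\<close> and
    \<open>e n\<close> those of \<open>T n\<close>; the \<open>case\<close> encodes the convention
    that the predecessor of \<open>W 0\<close> is zero.\<close>
  define e where "e n m = ((case n of 0 \<Rightarrow> 0 | Suc k \<Rightarrow> d k m) - d n m) / K" for n m
  have d0: "d n m = 0" if "m > Suc (Suc n) \<or> m < n" for n m
    using that by (auto simp: d_def)
  have e0: "e n m = 0" if "m > Suc (Suc n) \<or> Suc m < n" for n m
    using that by (auto simp: e_def d0 split: nat.split)
  have Wd: "W n x = (\<Sum>m\<le>N. d n m * \<phi> m x)" if "N \<ge> Suc (Suc n)" for n x N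
  proof -
    have "(\<Sum>m\<le>N. d n m * \<phi> m x) = (\<Sum>m\<in>{n, Suc n, Suc (Suc n)}. d n m * \<phi> m x)"
      using that by (intro sum.mono_neutral_right) (auto simp: d_def)
    then show ?thesis by (simp add: W d_def)
  qed
  have sub_m: "{m. e n m \<noteq> 0} \<subseteq> {..Suc (Suc n)}" for n
    using e0 by (force simp: not_less[symmetric])
  have sub_n: "{n. e n m \<noteq> 0} \<subseteq> {..Suc m}" for m
    using e0 by (force simp: not_less[symmetric])
  have tel: "(\<Sum>n\<le>N. e n m) = - d N m / K" for N m
    by (induction N) (simp_all add: e_def diff_divide_distrib)
  have Te: "T n x = (\<Sum>m | e n m \<noteq> 0. e n m * \<phi> m x)" if "x \<noteq> 0" for n x
  proof -
    have "(\<Sum>m | e n m \<noteq> 0. e n m * \<phi> m x) = (\<Sum>m\<le>Suc (Suc n). e n m * \<phi> m x)"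
      using sub_m by (intro sum.mono_neutral_left) auto
    also have "K * \<dots> = K * T n x"
    proof (cases n)
      case 0
      then show ?thesis
        using K T0[OF that] Wd[of 0 2 x]
        by (simp add: e_def sum_distrib_left sum_negf numeral_2_eq_2 del: sum.atMost_Suc)
    next
      case (Suc k)
      have "K * (\<Sum>m\<le>Suc (Suc n). e n m * \<phi> m x)
          = (\<Sum>m\<le>Suc (Suc n). d k m * \<phi> m x) - (\<Sum>m\<le>Suc (Suc n). d (Suc k) m * \<phi> m x)"
        unfolding sum_distrib_left sum_subtractf[symmetric] using K
        by (intro sum.cong) (auto simp: e_def Suc left_diff_distrib)
      also have "\<dots> = W k x - W (Suc k) x"
        by (simp only: Wd[of k "Suc (Suc n)"] Wd[of "Suc k" "Suc (Suc n)"] Suc order_refl le_SucI)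
      finally show ?thesis using TS[OF that] Suc by simp
    qed
    finally show ?thesis using K by simp
  qed
  have "(\<Sum>n | e n m \<noteq> 0. e n m) = 0" for m
  proof -
    \<comment> \<open>Summing up to \<open>Suc m\<close> includes every nonzero \<open>e n m\<close>
      and leaves the remainder \<open>- d (Suc m) m / K\<close>, which is zero because
      \<open>W (Suc m)\<close> starts only at \<open>\<phi> (Suc m)\<close>.\<close>
    have "(\<Sum>n | e n m \<noteq> 0. e n m) = (\<Sum>n\<le>Suc m. e n m)"
      using sub_n by (intro sum.mono_neutral_left) auto
    also have "\<dots> = 0" using d0[where n = "Suc m" and m = m] by (simp only: tel) simp
    finally show ?thesis .
  qed
  then show ?thesis
    unfolding coefficients_vanish_def
    using Te finite_subset[OF sub_m] finite_subset[OF sub_n] by (intro exI[of _ e]) auto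
qed

section \<open>The equation in normalised constants, and q-shifted factorials\<close>

text \<open>The factor \<open>q\<close> to the power -1/2 inside \<open>s\<close> and
  \<open>r\<close> absorbs all half-integer powers of \<open>q\<close>, so every coefficient is
  rational in \<open>q\<close>, \<open>L\<close>, \<open>A\<close>, \<open>s\<close>,
  \<open>r\<close> and identities become accessible to \<open>field_simps\<close>.\<close>

definition confl_op ::
  "complex \<Rightarrow> complex \<Rightarrow> complex \<Rightarrow> complex \<Rightarrow> complex
    \<Rightarrow> complex \<Rightarrow> complex \<Rightarrow> complex \<Rightarrow> complex \<Rightarrow> complex" where
  "confl_op q L A s r x gp gm g0 =
     (1 - x / s) * (1 - x / r) * gp / (q * L\<^sup>2) + gm
     - (x\<^sup>2 / (q * A * L\<^sup>2 * s * r) - (1 / s + 1 / r) * x / (q * L) + (1 + 1 / q) / L) * g0"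

lemma qpow_add: "qpow w (a + b) = qpow w a * qpow w b"
  and qpow_diff: "qpow w (a - b) = qpow w a / qpow w b"
  and qpow_minus: "qpow w (- a) = inverse (qpow w a)"
  and qpow_nonzero: "qpow w a \<noteq> 0"
  and qpow_one: "qpow w 1 = exp w"
  by (simp_all add: qpow_def ring_distribs exp_add exp_diff exp_minus)

lemma qpow_of_nat: "qpow w (of_nat n) = exp w ^ n"
  and qpow_of_nat_mult: "qpow w (of_nat n * a) = qpow w a ^ n"
  by (simp_all add: qpow_def exp_of_nat_mult mult.assoc)

lemma qpow_half_square: "qpow w (1 / 2) * qpow w (1 / 2) = exp w"
  by (simp add: qpow_def flip: exp_add)

lemma qpow_double: "qpow w (2 * a) = (qpow w a)\<^sup>2"
  using qpow_of_nat_mult[of w 2 a] by simp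

lemma qpoch_Suc: "qpoch a q (Suc n) = qpoch a q n * (1 - a * q ^ n)"
  by (simp add: qpoch_def)

lemma qpoch_0: "qpoch a q 0 = 1"
  by (simp add: qpoch_def)

text \<open>Used with \<open>a = x / s\<close>: the factor \<open>1 - x / s\<close> in front of
  \<open>g (q x)\<close> is absorbed and raises the index of the basis polynomial by one.\<close>

lemma qpoch_shift: "(1 - a) * qpoch (q * a) q n = qpoch a q (Suc n)"
  unfolding qpoch_def by (subst prod.lessThan_Suc_shift) (simp add: mult_ac)

lemma qpoch_divide_Suc: "q \<noteq> 0 \<Longrightarrow> qpoch (a / q) q (Suc n) = (1 - a / q) * qpoch a q n"
  using qpoch_shift[of "a / q" q n] by simp

lemma qpoch_self_nonzero:
  assumes "\<forall>n::nat. n > 0 \<longrightarrow> q ^ n \<noteq> (1::complex)"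
  shows "qpoch q q n \<noteq> 0"
  using assms by (auto simp: qpoch_def simp flip: power_Suc)

lemma confl_lhs_eq_confl_op:
  assumes "exp w = q"
  shows "confl_lhs q w l \<alpha> lam t =
    confl_op q (qpow w lam) (qpow w \<alpha>) (qpow w (l 1 - 1/2) * t 1) (qpow w (l 2 - 1/2) * t 2)"
proof (intro ext)
  fix x gp gm g0
  \<comment> \<open>With a square root \<open>h\<close> of \<open>q\<close> as the basic quantity,
    all the \<open>qpow\<close> factors become monomials and the two sides can be compared as
    rational expressions.\<close>
  define h where "h = qpow w (1 / 2)"
  have h: "q = h\<^sup>2" "h \<noteq> 0"
    using assms qpow_half_square[of w] by (simp_all add: h_def power2_eq_square qpow_nonzero)
  have e: "qpow w (- 2 * lam - 1) = 1 / (h\<^sup>2 * (qpow w lam)\<^sup>2)"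
      "qpow w (- l i + 1/2) = h / qpow w (l i)"
      "qpow w (l i - 1/2) = qpow w (l i) / h"
      "qpow w (- \<alpha> - l 1 - l 2 - 2 * lam) =
        1 / (qpow w \<alpha> * qpow w (l 1) * qpow w (l 2) * (qpow w lam)\<^sup>2)"
      "qpow w (- lam - 1/2) = 1 / (qpow w lam * h)" for i
    unfolding qpow_add qpow_diff qpow_minus mult_minus_left qpow_double qpow_one assms
      h_def[symmetric]
    using h by (simp_all add: qpow_nonzero field_simps)
  show "confl_lhs q w l \<alpha> lam t x gp gm g0 = confl_op q (qpow w lam) (qpow w \<alpha>)
      (qpow w (l 1 - 1/2) * t 1) (qpow w (l 2 - 1/2) * t 2) x gp gm g0"
    unfolding confl_lhs_def confl_op_def e qpow_minus[of w "l _"] qpow_minus[of w lam]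
    using h qpow_nonzero[of w] by (simp add: field_simps power2_eq_square)
qed

lemma confl_op_commute: "confl_op q L A s r = confl_op q L A r s"
  by (intro ext) (simp add: confl_op_def mult_ac add_ac)

section \<open>Degrees of the three families of basis polynomials\<close>

lemma polys_in_x_qpoch:
  assumes "q \<noteq> 0" "s \<noteq> 0"
  shows "polys_in_x (\<lambda>n x. qpoch (x / s) q n)"
  unfolding polys_in_x_def
proof (intro allI exI conjI impI)
  fix n
  let ?p = "\<Prod>j<n. [:1, - (q ^ j / s):]"
  show "?p \<noteq> 0" using assms by simp
  show "degree ?p = n"
    using assms by (subst degree_prod_sum_eq) auto
  show "qpoch (x / s) q n = poly ?p x" for x
    by (simp add: qpoch_def poly_prod)
qed

lemma polys_in_inverse_x_power: "polys_in_inverse_x (\<lambda>n x. inverse x ^ n)"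
  unfolding polys_in_inverse_x_def
proof
  show "\<exists>p. p \<noteq> 0 \<and> degree p = n \<and> (\<forall>x::complex. x \<noteq> 0 \<longrightarrow> inverse x ^ n = poly p (1 / x))"
    for n :: nat
    by (intro exI[of _ "monom 1 n"]) (simp add: degree_monom_eq poly_monom inverse_eq_divide)
qed

lemma polys_in_inverse_x_qpoch:
  assumes "s \<noteq> 0"
  shows "polys_in_inverse_x (\<lambda>n x. qpoch (x / s) q n * inverse x ^ n)"
  unfolding polys_in_inverse_x_def
proof (intro allI exI conjI impI)
  fix n
  \<comment> \<open>Each of the \<open>n\<close> factors of \<open>qpoch\<close> takes one
    \<open>inverse x\<close> and becomes \<open>1 / x - q ^ j / s\<close>, of degree one in
    \<open>1 / x\<close>.\<close>
  let ?p = "\<Prod>j<n. [:- (q ^ j / s), 1:]"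
  show "?p \<noteq> 0" by simp
  show "degree ?p = n"
    by (subst degree_prod_sum_eq) auto
  show "qpoch (x / s) q n * inverse x ^ n = poly ?p (1 / x)" if "x \<noteq> 0" for x
  proof -
    have "qpoch (x / s) q n * inverse x ^ n = (\<Prod>j<n. (1 - x / s * q ^ j) * inverse x)"
      by (simp add: qpoch_def prod.distrib)
    also have "\<dots> = poly ?p (1 / x)"
      unfolding poly_prod using that by (intro prod.cong) (auto simp: field_simps)
    finally show ?thesis .
  qed
qed

section \<open>Case (i): expansion in q-shifted factorials of x\<close>

lemma coefficients_vanish_2phi0:
  assumes nz: "q \<noteq> 0" "L \<noteq> 0" "A \<noteq> 0" "s \<noteq> 0" "r \<noteq> 0"
    and rec: "\<And>n. a (Suc n) * (1 - q ^ Suc n) = - s / (r * A * L * q ^ n) * (1 - A * L * q ^ n) * a n"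
  defines "\<phi> \<equiv> \<lambda>(n::nat) x. qpoch (x / s) q n"
  shows "coefficients_vanish \<phi>
    (\<lambda>n x. confl_op q L A s r x (L * (a n * \<phi> n (q * x))) (inverse L * (a n * \<phi> n (x / q)))
      (a n * \<phi> n x))" (is "coefficients_vanish _ ?T")
proof -
  define z where "z n = a (Suc n) * (q - 1 / q ^ n)" for n
  \<comment> \<open>The weights 1, -(1 + 1/q), 1/q are those of the expansion of
    \<open>(q ^ n * (x / s))\<^sup>2 * \<phi> n x\<close> in the basis, so \<open>W n\<close> is
    \<open>z n\<close> times this product.\<close>
  define W where "W n x = z n * \<phi> n x + (- z n * (1 + 1 / q)) * \<phi> (Suc n) x
    + z n / q * \<phi> (Suc (Suc n)) x" for n x
  have z: "z n = a n * s / (r * q ^ n) * (1 / (A * L * q ^ n) - 1)" for n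
  proof -
    have "z n = - (a (Suc n) * (1 - q ^ Suc n)) / q ^ n"
      using nz by (simp add: z_def field_simps)
    then show ?thesis unfolding rec using nz by (simp add: field_simps)
  qed
  have up: "(1 - x / s) * \<phi> n (q * x) = \<phi> (Suc n) x" for n x
    unfolding \<phi>_def using qpoch_shift[of "x / s" q n] by simp
  have down: "\<phi> (Suc n) (x / q) = (1 - x / s / q) * \<phi> n x" for n x
    unfolding \<phi>_def using qpoch_divide_Suc[of q "x / s" n] nz by (simp add: mult.commute)
  have Suc\<phi>: "\<phi> (Suc n) x = \<phi> n x * (1 - x / s * q ^ n)" for n x
    by (simp add: \<phi>_def qpoch_Suc)
  define \<rho> b where "\<rho> = s / r" and "b = 1 / (A * L)"
  have KT: "(q * L) * ?T n x = a n * ((1 - \<rho> * (x / s)) * \<phi> (Suc n) x + q * \<phi> n (x / q)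
      - (\<rho> * b * (x / s)\<^sup>2 - (1 + \<rho>) * (x / s) + (1 + q)) * \<phi> n x)" for n x
    unfolding confl_op_def up[symmetric] \<rho>_def b_def using nz
    by (simp add: field_simps power2_eq_square)
  have W: "W n x = z n * (q ^ n * (x / s))\<^sup>2 * \<phi> n x" for n x
    unfolding W_def Suc\<phi> using nz by (simp add: field_simps power2_eq_square)
  have \<phi>0: "\<phi> 0 x = 1" for x by (simp add: \<phi>_def qpoch_0)
  \<comment> \<open>The recurrence of \<open>a\<close> gives two forms of the same quantity, one
    with \<open>a (Suc n)\<close> and one with \<open>a n\<close>. Using the first for
    \<open>W n\<close> and the second for \<open>W (Suc n)\<close> gives both the factor
    \<open>a (Suc n)\<close> carried by \<open>?T (Suc n)\<close>.\<close>
  have z_old: "z n * (q ^ n * y)\<^sup>2 = a (Suc n) * (q * q ^ n - 1) * q ^ n * y\<^sup>2" for n y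
    using nz unfolding z_def by (simp add: field_simps power2_eq_square)
  have z_new: "z n * (q ^ n * y)\<^sup>2 = a n * \<rho> * (b - q ^ n) * y\<^sup>2" for n y
    using nz unfolding z \<rho>_def b_def by (simp add: field_simps power2_eq_square)
  show ?thesis
  proof (rule coefficients_vanish_telescope[where K = "q * L" and \<phi> = \<phi> and W = W and a = z
        and b = "\<lambda>n. - z n * (1 + 1 / q)" and c = "\<lambda>n. z n / q", OF _ W_def])
    show "q * L \<noteq> 0" using nz by simp
  next
    fix x :: complex
    show "q * L * ?T 0 x = - W 0 x"
      unfolding KT unfolding W z_new Suc\<phi> \<phi>0
      by (simp add: algebra_simps power2_eq_square add_divide_distrib diff_divide_distrib)
  next
    fix n and x :: complex
    define y Q where "y = x / s" and "Q = q ^ n"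
    \<comment> \<open>Now all three shifts are multiples of \<open>\<phi> n x\<close>, and a
      polynomial identity in \<open>y\<close>, \<open>Q\<close>, \<open>q\<close>,
      \<open>\<rho>\<close>, \<open>b\<close> remains.\<close>
    have down': "q * \<phi> (Suc n) (x / q) = (q - y) * \<phi> n x"
      unfolding down y_def[symmetric] using nz by (simp add: field_simps)
    show "q * L * ?T (Suc n) x = W n x - W (Suc n) x"
      unfolding KT down' W y_def[symmetric] z_old[of n] z_new[of "Suc n"]
      unfolding Suc\<phi> y_def[symmetric] power_Suc Q_def[symmetric]
      by (simp add: algebra_simps power2_eq_square)
  qed
qed

section \<open>Case (ii): inverse powers and Rogers-Szego polynomials\<close>

text \<open>Powers of x are eigenfunctions of the dilation, so each term produces only three powers.
  Collecting the coefficient of \<open>inverse x ^ m\<close> gives \<open>qpoch (A * L) q m\<close>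
  times the recurrence of \<open>h\<close> at index m; \<open>rec0\<close> is its case m = 1, with
  \<open>h\<close> read as zero at index -1.\<close>

lemma coefficients_vanish_inverse_power:
  assumes nz: "q \<noteq> 0" "L \<noteq> 0" "A \<noteq> 0" "s \<noteq> 0" "r \<noteq> 0"
    and rec0: "h 1 * (1 - q) = (s + r) * h 0"
    and rec: "\<And>n. h (Suc (Suc n)) * (1 - q ^ Suc (Suc n)) = (s + r) * h (Suc n) - s * r * h n"
  defines "a \<equiv> \<lambda>n. q ^ n * qpoch (A * L) q n * h n"
  defines "\<phi> \<equiv> \<lambda>(n::nat) x. inverse x ^ n"
  shows "coefficients_vanish \<phi>
    (\<lambda>n x. confl_op q L A s r x (inverse A * (a n * \<phi> n (q * x))) (A * (a n * \<phi> n (x / q)))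
      (a n * \<phi> n x) / x\<^sup>2)" (is "coefficients_vanish _ ?T")
proof -
  define B where "B = A * L"
  define M where "M n = qpoch B q n" for n
  have SucM: "M (Suc n) = M n * (1 - B * q ^ n)" for n
    by (simp add: M_def qpoch_Suc)
  have a: "a n = q ^ n * M n * h n" for n by (simp add: a_def M_def B_def)
  \<comment> \<open>Up to the factor \<open>K\<close>, \<open>p n\<close> is what
    \<open>\<phi> (Suc n)\<close> still lacks after the terms \<open>0..n\<close>, namely the
    contribution of term \<open>Suc n\<close>; \<open>c n\<close> is what
    \<open>\<phi> (Suc (Suc n))\<close> has received so far, namely from term
    \<open>n\<close>.\<close>
  define p where "p n = M (Suc n) * (h (Suc n) * (1 - q ^ Suc n))" for n
  define c where "c n = s * r * M (Suc (Suc n)) * h n" for n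
  define W where "W n x = 0 * \<phi> n x + p n * \<phi> (Suc n) x + (- c n) * \<phi> (Suc (Suc n)) x" for n x
  have KT: "(q * L\<^sup>2 * A * s * r) * ?T n x =
      M n * h n * ((1 - q ^ n) * \<phi> n x - (s + r) * (1 - B * q ^ n) * \<phi> (Suc n) x
        + s * r * (1 - B * q ^ n) * (1 - B * q ^ Suc n) * \<phi> (Suc (Suc n)) x)"
    if "x \<noteq> 0" for n x
  proof -
    have "q ^ n \<noteq> 0" "x ^ n \<noteq> 0" using nz that by simp_all
    then show ?thesis
      unfolding confl_op_def a \<phi>_def B_def power_mult_distrib power_divide power_inverse
        inverse_mult_distrib power_Suc using nz that by (simp add: field_simps power2_eq_square)
  qed
  have p0: "p 0 = M 1 * ((s + r) * h 0)" using rec0 by (simp add: p_def)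
  have pS: "p (Suc n) = M (Suc (Suc n)) * ((s + r) * h (Suc n) - s * r * h n)" for n
    by (simp only: p_def rec)
  show ?thesis
  proof (rule coefficients_vanish_telescope[where K = "q * L\<^sup>2 * A * s * r" and \<phi> = \<phi> and W = W
        and a = "\<lambda>_. 0" and b = p and c = "\<lambda>n. - c n", OF _ W_def])
    show "q * L\<^sup>2 * A * s * r \<noteq> 0" using nz by simp
  next
    fix x :: complex assume "x \<noteq> 0"
    show "q * L\<^sup>2 * A * s * r * ?T 0 x = - W 0 x"
      unfolding KT[OF \<open>x \<noteq> 0\<close>] unfolding W_def p0 c_def One_nat_def SucM by (simp add: algebra_simps)
  next
    fix n and x :: complex assume "x \<noteq> 0"
    show "q * L\<^sup>2 * A * s * r * ?T (Suc n) x = W n x - W (Suc n) x"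
      unfolding KT[OF \<open>x \<noteq> 0\<close>] unfolding W_def pS c_def SucM p_def[of n] by (simp add: algebra_simps)
  qed
qed

text \<open>The \<open>h n\<close> are the coefficients of H = \<open>f s * f r\<close>, and H(qz) =
  (1 - sz)(1 - rz) H(z). Both claims are coefficient comparisons in this functional
  equation.\<close>

lemma rogers_szego_recurrence:
  fixes s r q :: complex
  assumes "\<forall>n::nat. n > 0 \<longrightarrow> q ^ n \<noteq> 1"
  defines "h \<equiv> \<lambda>n. \<Sum>k=0..n. s ^ k * r ^ (n - k) / (qpoch q q k * qpoch q q (n - k))"
  shows "h (Suc (Suc n)) * (1 - q ^ Suc (Suc n)) = (s + r) * h (Suc n) - s * r * h n"
    and "h 1 * (1 - q) = (s + r) * h 0"
proof -
  define f where "f u = Abs_fps (\<lambda>k. u ^ k / qpoch q q k)" for u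
  \<comment> \<open>\<open>g\<close> is the dilation F(z) to F(qz); its multiplicativity reduces the
    functional equation of the product to that of the single factors.\<close>
  define g where "g F = Abs_fps (\<lambda>k. q ^ k * fps_nth F k)" for F :: "complex fps"
  have gmult: "g (F * G) = g F * g G" for F G
    by (rule fps_ext) (auto simp: g_def fps_mult_nth sum_distrib_left mult_ac
        intro!: sum.cong simp flip: power_add)
  have fun_eq: "g (f u) = f u - fps_const u * (fps_X * f u)" for u
  proof (rule fps_ext)
    fix n
    show "fps_nth (g (f u)) n = fps_nth (f u - fps_const u * (fps_X * f u)) n"
    proof (cases n)
      case (Suc m)
      have "1 - q * q ^ m \<noteq> 0" using assms(1)[rule_format, of "Suc m"] by simp
      then show ?thesis using qpoch_self_nonzero[OF assms(1), of m]
        by (simp add: Suc g_def f_def qpoch_Suc field_simps)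
    qed (simp add: g_def f_def)
  qed
  let ?H = "f s * f r"
  have h: "fps_nth ?H n = h n" for n
    by (auto simp: fps_mult_nth f_def h_def intro!: sum.cong)
  have "g ?H = ?H - fps_const (s + r) * (fps_X * ?H) + fps_const (s * r) * (fps_X * (fps_X * ?H))"
    unfolding gmult fun_eq
    by (simp add: algebra_simps flip: fps_const_add fps_const_mult)
  then have eq: "fps_nth (g ?H) n = fps_nth (?H - fps_const (s + r) * (fps_X * ?H)
      + fps_const (s * r) * (fps_X * (fps_X * ?H))) n" for n by simp
  have g_nth: "fps_nth (g ?H) n = q ^ n * h n" for n
    unfolding g_def by (simp add: h)
  show "h (Suc (Suc n)) * (1 - q ^ Suc (Suc n)) = (s + r) * h (Suc n) - s * r * h n"
    using eq[of "Suc (Suc n)"] unfolding g_nth fps_add_nth fps_sub_nth fps_mult_left_const_nth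
      fps_X_mult_nth h by (simp add: algebra_simps)
  show "h 1 * (1 - q) = (s + r) * h 0"
    using eq[of "Suc 0"] unfolding g_nth fps_add_nth fps_sub_nth fps_mult_left_const_nth
      fps_X_mult_nth h by (simp add: algebra_simps)
qed

section \<open>Case (iii): Stieltjes-Wigert polynomials\<close>

text \<open>Passing from base q to 1/q multiplies the q-binomial coefficient by
  \<open>q ^ (k * (n - k))\<close> when read backwards, so \<open>(q;q)_n * c n\<close> is the sum
  of \<open>q^(-k^2) * z^k\<close> times the binomial in base 1/q. The recurrence is proved by
  writing all its members as sums of one common \<open>D k\<close> with multipliers depending on
  \<open>q ^ k\<close>, and comparing these termwise.\<close>

lemma stieltjes_wigert_recurrence:
  fixes q z :: complex
  assumes q: "q \<noteq> 0" and root: "\<forall>n::nat. n > 0 \<longrightarrow> q ^ n \<noteq> 1"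
  defines "c \<equiv> \<lambda>n. \<Sum>k=0..n. z ^ k / (q ^ (n * k) * qpoch q q (n - k) * qpoch q q k)"
  shows "c (Suc (Suc n)) * (1 - q ^ Suc (Suc n)) =
      (1 + 1 / q - 1 / q ^ Suc (Suc n) + z / q ^ (2 * n + 3)) * c (Suc n) + c n / q ^ Suc (Suc n)"
    and "c 1 * (1 - q) = (1 + z / q) * c 0"
proof -
  have nz: "qpoch q q n \<noteq> 0" "1 - q ^ Suc n \<noteq> 0" for n
    using qpoch_self_nonzero[OF root] root[rule_format, of "Suc n"] by auto
  \<comment> \<open>\<open>G n k\<close> is \<open>1 / (q;q)\<^bsub>n-k\<^esub>\<close> extended by zero to \<open>k > n\<close>, so that the recurrence can be checked
    coefficientwise over one common range of summation.\<close>
  define G where "G n k = (if k \<le> n then 1 / qpoch q q (n - k) else 0)" for n k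
  define f where "f k = 1 / qpoch q q k" for k
  \<comment> \<open>At \<open>k = Suc n\<close> the factor on the right vanishes, in agreement with
    the extension by zero.\<close>
  have G: "G n k = (1 - q ^ Suc n / q ^ k) * G (Suc n) k" for n k
  proof (cases "k \<le> n")
    case True
    have "q ^ Suc n / q ^ k = q * q ^ (n - k)"
      using q True by (simp add: power_diff)
    then show ?thesis using True nz[of "n - k"]
      by (simp add: G_def Suc_diff_le qpoch_Suc)
  qed (use q in \<open>auto simp: G_def not_le less_Suc_eq_le le_Suc_eq\<close>)
  have f: "f k = (1 - q ^ Suc k) * f (Suc k)" for k
    using nz[of k] by (simp add: f_def qpoch_Suc)
  have c: "c n = (\<Sum>k\<le>N. z ^ k / q ^ (n * k) * G n k * f k)" if "n \<le> N" for n N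
  proof -
    have "c n = (\<Sum>k\<in>{0..n}. z ^ k / q ^ (n * k) * G n k * f k)"
      unfolding c_def by (intro sum.cong) (auto simp: G_def f_def)
    also have "\<dots> = (\<Sum>k\<le>N. z ^ k / q ^ (n * k) * G n k * f k)"
      using that by (intro sum.mono_neutral_left) (auto simp: G_def)
    finally show ?thesis .
  qed
  let ?N = "Suc (Suc n)"
  \<comment> \<open>The middle power of \<open>q\<close> and the largest index of \<open>G\<close>
    are taken, so that \<open>c ?N\<close>, \<open>c (Suc n)\<close> and \<open>c n\<close> all have
    multipliers without denominators in \<open>1 - q ^ j\<close>.\<close>
  define D where "D k = z ^ k / q ^ (Suc n * k) * G ?N k * f k" for k
  have c2: "c ?N = (\<Sum>k\<le>?N. D k / q ^ k)"
    unfolding c[OF order_refl] D_def by (intro sum.cong) (auto simp: power_add)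
  have c1: "c (Suc n) = (\<Sum>k\<le>?N. (1 - q ^ ?N / q ^ k) * D k)"
    unfolding c[OF le_SucI[OF order_refl]] D_def G[of "Suc n"] by (intro sum.cong) (auto simp: mult_ac)
  have c0: "c n = (\<Sum>k\<le>?N. q ^ k * (1 - q ^ Suc n / q ^ k) * (1 - q ^ ?N / q ^ k) * D k)"
    unfolding c[OF le_SucI[OF le_SucI[OF order_refl]]] D_def G[of "n"] G[of "Suc n"]
    using q by (intro sum.cong) (auto simp: power_add)
  \<comment> \<open>The factor \<open>z\<close> raises the power of \<open>z\<close>, so the
    summation index is shifted by one; the new term \<open>k = 0\<close> is killed by
    \<open>1 - q ^ 0\<close>. In the recurrence, \<open>2 * n + 3\<close> splits as
    \<open>Suc n\<close> used here plus \<open>?N\<close>.\<close>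
  have zc: "z / q ^ Suc n * c (Suc n) = (\<Sum>k\<le>?N. (1 - q ^ k) * D k)"
  proof -
    have "(\<Sum>k\<le>?N. (1 - q ^ k) * D k) = (\<Sum>k\<le>Suc n. (1 - q ^ Suc k) * D (Suc k))"
      by (subst sum.atMost_Suc_shift) simp
    also have "\<dots> = (\<Sum>k\<le>Suc n. z / q ^ Suc n * (z ^ k / q ^ (Suc n * k) * G (Suc n) k * f k))"
    proof (intro sum.cong refl)
      fix k
      have "G ?N (Suc k) = G (Suc n) k" by (simp add: G_def)
      then show "(1 - q ^ Suc k) * D (Suc k) =
          z / q ^ Suc n * (z ^ k / q ^ (Suc n * k) * G (Suc n) k * f k)"
        unfolding D_def f[of k] by (simp add: power_add mult_ac)
    qed
    finally show ?thesis by (simp add: c[OF order_refl] sum_distrib_left del: sum.atMost_Suc)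
  qed
  have "(1 + 1 / q - 1 / q ^ ?N) * c (Suc n) + 1 / q ^ ?N * (z / q ^ Suc n * c (Suc n)) + c n / q ^ ?N
      = (\<Sum>k\<le>?N. (1 - q ^ ?N) * (D k / q ^ k))"
    unfolding zc unfolding c1 c0 sum_distrib_left sum_divide_distrib sum.distrib[symmetric]
  proof (intro sum.cong refl)
    fix k
    have "q ^ k \<noteq> 0" "q ^ n \<noteq> 0" using q by auto
    then show "(1 + 1 / q - 1 / q ^ ?N) * ((1 - q ^ ?N / q ^ k) * D k) + 1 / q ^ ?N * ((1 - q ^ k) * D k)
        + q ^ k * (1 - q ^ Suc n / q ^ k) * (1 - q ^ ?N / q ^ k) * D k / q ^ ?N
        = (1 - q ^ ?N) * (D k / q ^ k)"
      using q unfolding power_Suc by (simp add: field_simps)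
  qed
  also have "\<dots> = c ?N * (1 - q ^ ?N)"
    unfolding c2 sum_distrib_right by (simp add: mult_ac)
  also have "1 / q ^ ?N * (z / q ^ Suc n * c (Suc n)) = z / q ^ (2 * n + 3) * c (Suc n)"
    by (simp add: power_add mult_2 mult_2_right power2_eq_square numeral_3_eq_3 mult_ac)
  finally show "c ?N * (1 - q ^ ?N) =
      (1 + 1 / q - 1 / q ^ ?N + z / q ^ (2 * n + 3)) * c (Suc n) + c n / q ^ ?N"
    by (simp add: ring_distribs del: power_Suc)
  show "c 1 * (1 - q) = (1 + z / q) * c 0"
  proof -
    have "c 1 = (1 + z / q) / (1 - q)" "c 0 = 1"
      using q by (simp_all add: c_def qpoch_def add_divide_distrib)
    then show ?thesis using nz(2)[of 0] by simp
  qed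
qed

lemma coefficients_vanish_stieltjes_wigert:
  assumes nz: "q \<noteq> 0" "L \<noteq> 0" "A \<noteq> 0" "s \<noteq> 0" "r \<noteq> 0"
    and rec0: "c 1 * (1 - q) = (1 + s / (r * A * L) / q) * c 0"
    and rec: "\<And>n. c (Suc (Suc n)) * (1 - q ^ Suc (Suc n)) =
      (1 + 1 / q - 1 / q ^ Suc (Suc n) + s / (r * A * L) / q ^ (2 * n + 3)) * c (Suc n)
      + c n / q ^ Suc (Suc n)"
    and M: "\<And>n. M (Suc n) = - s / (A * L * q ^ n) * (1 - A * L * q ^ n) * M n"
  defines "\<phi> \<equiv> \<lambda>(n::nat) x. qpoch (x / s) q n * inverse x ^ n"
  shows "coefficients_vanish \<phi>
    (\<lambda>n x. confl_op q L A s r x (inverse A * (M n * c n * \<phi> n (q * x)))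
      (A * (M n * c n * \<phi> n (x / q))) (M n * c n * \<phi> n x) / x\<^sup>2)" (is "coefficients_vanish _ ?T")
proof -
  define B where "B = A * L"
  have B: "B \<noteq> 0" using nz by (simp add: B_def)
  define z where "z n = M (Suc n) * B\<^sup>2 * q ^ (3 * n + 1) * (- (c (Suc n) * (1 - q ^ Suc n)))" for n
  define u where "u n = M n * c n / q ^ n * (1 - B * q ^ n) * (1 - B * q ^ Suc n)" for n
  \<comment> \<open>This is \<open>1 / x\<close> times \<open>z n / q ^ n * \<phi> n x - u n *
    s\<^sup>2 * \<phi> (Suc n) x\<close>, expanded by the rule that \<open>\<phi> m x / x\<close>
    equals \<open>\<phi> (Suc m) x + q ^ m / s * \<phi> m x\<close>.\<close>
  define W where "W n x = z n / s * \<phi> n x + (z n / q ^ n - u n * q ^ Suc n * s) * \<phi> (Suc n) x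
    + (- u n * s\<^sup>2) * \<phi> (Suc (Suc n)) x" for n x
  have up: "(1 - x / s) * \<phi> n (q * x) = \<phi> (Suc n) x * x / q ^ n" if "x \<noteq> 0" for n x
    unfolding \<phi>_def using qpoch_shift[of "x / s" q n] that nz by (simp add: field_simps)
  have down: "\<phi> (Suc n) (x / q) = (1 - x / s / q) * q ^ Suc n / x * \<phi> n x" if "x \<noteq> 0" for n x
  proof -
    have *: "x / q / s = x / s / q" by simp
    show ?thesis
      unfolding \<phi>_def * qpoch_divide_Suc[OF nz(1)] using that nz by (simp add: field_simps)
  qed
  have Suc\<phi>: "\<phi> (Suc n) x = \<phi> n x * (1 / x - q ^ n / s)" if "x \<noteq> 0" for n x
    using that by (simp add: \<phi>_def qpoch_Suc field_simps)
  have \<phi>0: "\<phi> 0 x = 1" for x by (simp add: \<phi>_def qpoch_0)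
  define \<rho> where "\<rho> = s / r"
  have KT: "(q * L\<^sup>2 * A * s\<^sup>2) * ?T n x = M n * c n *
      ((s / x - \<rho>) * s / q ^ n * \<phi> (Suc n) x + q * B\<^sup>2 * (s / x)\<^sup>2 * \<phi> n (x / q)
      - (\<rho> - B * (1 + \<rho>) * (s / x) + B * (1 + q) * (s / x)\<^sup>2) * \<phi> n x)" (is "_ = ?R")
    if "x \<noteq> 0" for n x
  proof -
    have "(q * L\<^sup>2 * A * s\<^sup>2) * ?T n x = M n * c n *
      (s\<^sup>2 / x\<^sup>2 * (1 - x / r) * ((1 - x / s) * \<phi> n (q * x)) + q * B\<^sup>2 * s\<^sup>2 / x\<^sup>2 * \<phi> n (x / q)
      - (s / r - B * (1 + s / r) * s / x + B * (1 + q) * s\<^sup>2 / x\<^sup>2) * \<phi> n x)"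
      unfolding confl_op_def B_def using nz that by (simp add: field_simps power2_eq_square)
    also have "\<dots> = ?R"
      unfolding up[OF that] \<rho>_def using nz that by (simp add: field_simps power2_eq_square)
    finally show ?thesis .
  qed
  have z0: "z 0 = s * M 0 * (1 - B) * (B * q + \<rho>) * c 0"
  proof -
    have c1: "c (Suc 0) * (1 - q ^ Suc 0) = (1 + \<rho> / (B * q)) * c 0"
      using rec0 nz by (simp add: B_def \<rho>_def field_simps)
    show ?thesis
      unfolding z_def c1 M B_def[symmetric] using B nz by (simp add: field_simps power2_eq_square)
  qed
  \<comment> \<open>The recurrence trades \<open>c (Suc (Suc n))\<close> for
    \<open>c (Suc n)\<close> and \<open>c n\<close>. The \<open>c n\<close> part cancels in
    \<open>W n - W (Suc n)\<close> against the one from \<open>u n\<close>, as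
    \<open>?T (Suc n)\<close> contains only \<open>c (Suc n)\<close>.\<close>
  have zS: "z (Suc n) = s * M (Suc n) * (1 - B * q ^ Suc n) *
      ((B * (q ^ Suc n)\<^sup>2 * (q + 1) - B * q ^ Suc n + \<rho>) * c (Suc n) + B * q ^ Suc n * c n)" for n
  proof -
    define Q where "Q = q ^ n"
    have Q: "Q \<noteq> 0" using nz by (simp add: Q_def)
    have Qs: "q ^ (2 * n + 3) = q ^ 3 * Q\<^sup>2" "q ^ (3 * Suc n + 1) = q ^ 4 * Q ^ 3"
      by (simp_all add: Q_def power_add power_mult mult.commute flip: power_mult)
    have coeff: "s / (r * A * L) = \<rho> / B" by (simp add: B_def \<rho>_def)
    show ?thesis
      unfolding z_def rec Qs coeff unfolding M[of "Suc n"] B_def[symmetric] power_Suc Q_def[symmetric]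
      using B nz Q by (simp add: field_simps power2_eq_square power3_eq_cube power4_eq_xxxx)
  qed
  have W: "W n x = s / x * \<phi> n x * (z n / (s * q ^ n) - u n * (s / x - q ^ n))" if "x \<noteq> 0" for n x
    unfolding W_def Suc\<phi>[OF that] using nz that by (simp add: field_simps power2_eq_square)
  show ?thesis
  proof (rule coefficients_vanish_telescope[where K = "q * L\<^sup>2 * A * s\<^sup>2" and \<phi> = \<phi> and W = W
        and a = "\<lambda>n. z n / s" and b = "\<lambda>n. z n / q ^ n - u n * q ^ Suc n * s"
        and c = "\<lambda>n. - u n * s\<^sup>2", OF _ W_def])
    show "q * L\<^sup>2 * A * s\<^sup>2 \<noteq> 0" using nz by simp
  next
    fix x :: complex assume x: "x \<noteq> 0"
    define v where "v = s / x"
    have Suc\<phi>0: "\<phi> (Suc 0) x = (v - 1) / s"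
      unfolding Suc\<phi>[OF x] \<phi>0 v_def using nz by (simp add: field_simps)
    show "q * L\<^sup>2 * A * s\<^sup>2 * ?T 0 x = - W 0 x"
      unfolding KT[OF x] unfolding W[OF x] z0 u_def \<phi>0 Suc\<phi>0 v_def[symmetric]
      using nz by (simp add: field_simps power2_eq_square)
  next
    fix n and x :: complex assume x: "x \<noteq> 0"
    define v Q where "v = s / x" and "Q = q ^ n"
    have Q: "Q \<noteq> 0" using nz by (simp add: Q_def)
    have uS: "u n = - M (Suc n) * B / s * c n * (1 - B * q * Q)"
      unfolding u_def M B_def[symmetric] Q_def[symmetric] power_Suc
      using nz B Q by (simp add: field_simps)
    have down': "\<phi> (Suc n) (x / q) = (q * v - 1) * Q / s * \<phi> n x"
      unfolding down[OF x] v_def Q_def using nz x by (simp add: field_simps)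
    have Suc\<phi>': "\<phi> (Suc n) x = (v - Q) / s * \<phi> n x"
        "\<phi> (Suc (Suc n)) x = (v - q * Q) / s * ((v - Q) / s * \<phi> n x)"
      unfolding Suc\<phi>[OF x] v_def Q_def using nz x by (simp_all add: field_simps)
    \<comment> \<open>\<open>lhs\<close>, \<open>W0\<close> and \<open>W1\<close> extract one common
      prefactor; what remains is a polynomial identity, without division.\<close>
    have lhs: "q * L\<^sup>2 * A * s\<^sup>2 * ?T (Suc n) x = M (Suc n) * \<phi> n x / (s * (q * Q)) *
      (c (Suc n) * ((v - \<rho>) * (v - q * Q) * (v - Q) + q\<^sup>2 * Q\<^sup>2 * B\<^sup>2 * v\<^sup>2 * (q * v - 1)
        - q * Q * (\<rho> - B * (1 + \<rho>) * v + B * (1 + q) * v\<^sup>2) * (v - Q)))"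
      unfolding KT[OF x] unfolding down' v_def[symmetric] unfolding Suc\<phi>' power_Suc Q_def[symmetric]
      using nz Q by (simp add: field_simps power2_eq_square)
    have W0: "W n x = M (Suc n) * \<phi> n x / (s * (q * Q)) * (v * (B * q * Q * c n * (1 - B * q * Q) * (v - Q)
        - B\<^sup>2 * q\<^sup>2 * Q ^ 3 * c (Suc n) * (1 - q * Q)))"
    proof -
      have zn: "z n = - M (Suc n) * B\<^sup>2 * q * Q ^ 3 * c (Suc n) * (1 - q * Q)"
        by (simp add: z_def Q_def power_add power_mult mult.commute flip: power_mult)
      show ?thesis
        unfolding W[OF x] uS zn v_def[symmetric] Q_def[symmetric]
        using nz Q by (simp add: field_simps power2_eq_square power3_eq_cube)
    qed
    have W1: "W (Suc n) x = M (Suc n) * \<phi> n x / (s * (q * Q)) * (v * (v - Q) * (1 - B * q * Q) *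
        ((B * (q * Q)\<^sup>2 * (q + 1) - B * (q * Q) + \<rho>) * c (Suc n) + B * (q * Q) * c n
        - c (Suc n) * (1 - B * q * (q * Q)) * (v - q * Q)))"
      unfolding W[OF x] zS u_def v_def[symmetric] Suc\<phi>' power_Suc Q_def[symmetric]
      using nz Q by (simp add: field_simps)
    show "q * L\<^sup>2 * A * s\<^sup>2 * ?T (Suc n) x = W n x - W (Suc n) x"
      unfolding lhs W0 W1 right_diff_distrib[symmetric]
      by (rule arg_cong[where f = "(*) _"]) (simp add: algebra_simps power2_eq_square power3_eq_cube)
  qed
qed

section \<open>Return to the original parameters\<close>

lemma formal_solution_2phi0:
  assumes q: "exp w = q" "q \<noteq> 0" and root: "\<forall>n::nat. n > 0 \<longrightarrow> q ^ n \<noteq> 1"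
    and t: "t \<noteq> 0" "t' \<noteq> 0"
    and E: "E = confl_op q (qpow w lam) (qpow w \<alpha>) (qpow w (l - 1/2) * t) (qpow w (l' - 1/2) * t')"
  shows "formal_solution q w E lam
    (\<lambda>n. (- qpow w (- lam - \<alpha> + l - l') * t / t') ^ n
      * (qpow w (- (of_nat n * (of_nat n - 1) / 2)) * qpoch (qpow w (lam + \<alpha>)) q n)
      / qpoch q q n)
    (\<lambda>n x. qpoch (x / (qpow w (l - 1/2) * t)) q n)" (is "formal_solution _ _ _ _ ?a ?\<phi>")
proof -
  let ?s = "qpow w (l - 1/2) * t" and ?r = "qpow w (l' - 1/2) * t'"
  let ?L = "qpow w lam" and ?A = "qpow w \<alpha>"
  have "?a (Suc n) * (1 - q ^ Suc n) = - ?s / (?r * ?A * ?L * q ^ n) * (1 - ?A * ?L * q ^ n) * ?a n"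
    for n
  proof -
    have nz: "qpoch q q n \<noteq> 0" "1 - q * q ^ n \<noteq> 0"
      using qpoch_self_nonzero[OF root] root[rule_format, of "Suc n"] by auto
    have exponent: "- (of_nat (Suc n) * (of_nat (Suc n) - 1) / (2 :: complex))
        = - (of_nat n * (of_nat n - 1) / 2) - of_nat n" for n :: nat
      by (simp add: field_simps)
    show ?thesis
      unfolding exponent qpow_diff[of w _ "of_nat n"] qpow_of_nat q(1) qpoch_Suc power_Suc
        qpow_add[of w lam] qpow_diff[of w _ "1/2"] qpow_diff[of w _ l'] qpow_diff[of w _ \<alpha>]
        qpow_add[of w _ l] qpow_minus[of w lam]
      using nz t q(2) by (simp add: qpow_nonzero field_simps)
  qed
  then have "coefficients_vanish ?\<phi> (\<lambda>n. lhs_term q w E lam (\<lambda>x. ?a n * ?\<phi> n x))"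
    unfolding lhs_term_def E qpow_minus[of w lam]
    by (intro coefficients_vanish_2phi0[where a = ?a]) (use q t in \<open>simp_all add: qpow_nonzero\<close>)
  then show ?thesis
    unfolding formal_solution_def using polys_in_x_qpoch[of q ?s] q t by (simp add: qpow_nonzero)
qed

lemma bhs_term_2phi0:
  assumes q: "exp w = q" "q \<noteq> 0"
  shows "(- c) ^ n * (qpow w (- (of_nat n * (of_nat n - 1) / 2)) * qpoch a q n)
      / qpoch q q n * qpoch b q n = bhs_term [a, b] [] q c n"
proof -
  \<comment> \<open>Evenness makes the integer division exact, and at \<open>n = 0\<close> the
    truncated subtraction is harmless.\<close>
  have half: "of_nat (n * (n - 1) div 2) = (of_nat n * (of_nat n - 1) / 2 :: complex)"
  proof -
    have "even (n * (n - 1))" by (cases n) simp_all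
    then obtain m where m: "n * (n - 1) = 2 * m" by blast
    have eq: "of_nat n * (of_nat n - 1) = (of_nat (n * (n - 1)) :: complex)"
      by (cases n) (simp_all add: algebra_simps)
    show ?thesis unfolding eq m by simp
  qed
  have sign: "inverse ((- 1) ^ n) = ((- 1) ^ n :: complex)"
    by (simp flip: power_inverse)
  have pw: "qpow w (- (of_nat n * (of_nat n - 1) / 2)) = inverse (q ^ (n * (n - 1) div 2))"
    unfolding qpow_minus half[symmetric] qpow_of_nat q(1) ..
  \<comment> \<open>With two upper and no lower parameters the exponent is -1; this inverts the
    power of \<open>q\<close>, and the remaining sign turns \<open>c\<close> into
    \<open>- c\<close>.\<close>
  have "((- 1) ^ n * q ^ (n * (n - 1) div 2)) powi (1 + int (length ([] :: complex list)) - int (length [a, b]))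
      = (- 1) ^ n * inverse (q ^ (n * (n - 1) div 2))"
    by (simp add: power_int_minus sign del: power_inverse)
  then show ?thesis
    unfolding bhs_term_def pw power_minus[of c] by (simp only:) (simp add: divide_inverse mult_ac)
qed

lemma formal_solution_inverse_power:
  assumes q: "exp w = q" "q \<noteq> 0" and root: "\<forall>n::nat. n > 0 \<longrightarrow> q ^ n \<noteq> 1"
    and t: "t \<noteq> 0" "t' \<noteq> 0"
    and E: "E = confl_op q (qpow w lam) (qpow w \<alpha>) (qpow w (l - 1/2) * t) (qpow w (l' - 1/2) * t')"
  shows "formal_solution q w E (- \<alpha>)
    (\<lambda>n. qpow w (1/2) ^ n * qpoch (qpow w (lam + \<alpha>)) q n
      * (\<Sum>k=0..n. (qpow w l * t) ^ k * (qpow w l' * t') ^ (n - k)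
          / (qpoch q q k * qpoch q q (n - k))))
    (\<lambda>n x. inverse x ^ n)" (is "formal_solution _ _ _ _ ?a ?\<phi>")
proof -
  let ?s = "qpow w (l - 1/2) * t" and ?r = "qpow w (l' - 1/2) * t'"
  let ?L = "qpow w lam" and ?A = "qpow w \<alpha>"
  let ?h = "\<lambda>n. \<Sum>k=0..n. ?s ^ k * ?r ^ (n - k) / (qpoch q q k * qpoch q q (n - k))"
  define u where "u = qpow w (1/2)"
  have u: "u \<noteq> 0" "u * u = q"
    unfolding u_def using q by (simp_all add: qpow_half_square qpow_nonzero)
  have a: "?a n = q ^ n * qpoch (?A * ?L) q n * ?h n" for n
  proof -
    \<comment> \<open>Replacing the bases by \<open>u * ?s\<close> and \<open>u * ?r\<close> yields
      \<open>u ^ n\<close> by homogeneity; with the explicit \<open>u ^ n\<close> of the coefficient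
      this makes \<open>q ^ n\<close>.\<close>
    have "(qpow w l * t) ^ k * (qpow w l' * t') ^ (n - k) = u ^ n * (?s ^ k * ?r ^ (n - k))"
      if "k \<le> n" for k
    proof -
      have shift: "qpow w l * t = u * ?s" "qpow w l' * t' = u * ?r"
        using u by (simp_all add: qpow_diff u_def)
      show ?thesis
        unfolding shift using that by (simp add: power_mult_distrib mult_ac flip: power_add)
    qed
    then have "(\<Sum>k=0..n. (qpow w l * t) ^ k * (qpow w l' * t') ^ (n - k)
          / (qpoch q q k * qpoch q q (n - k))) = u ^ n * ?h n"
      unfolding sum_distrib_left by (intro sum.cong) simp_all
    moreover have "q ^ n = u ^ n * u ^ n"
      by (simp add: u(2) flip: power_mult_distrib)
    ultimately show ?thesis
      by (simp add: u_def[symmetric] qpow_add mult_ac)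
  qed
  have "coefficients_vanish ?\<phi> (\<lambda>n x. lhs_term q w E (- \<alpha>) (\<lambda>x. ?a n * ?\<phi> n x) x / x\<^sup>2)"
    unfolding a lhs_term_def E minus_minus qpow_minus[of w \<alpha>]
    using rogers_szego_recurrence[OF root, of ?s ?r] q t
    by (intro coefficients_vanish_inverse_power[where h = ?h]) (simp_all add: qpow_nonzero)
  then show ?thesis
    unfolding formal_solution_def using polys_in_inverse_x_power by simp
qed

lemma formal_solution_stieltjes_wigert:
  assumes q: "exp w = q" "q \<noteq> 0" and root: "\<forall>n::nat. n > 0 \<longrightarrow> q ^ n \<noteq> 1"
    and t: "t \<noteq> 0" "t' \<noteq> 0"
    and E: "E = confl_op q (qpow w lam) (qpow w \<alpha>) (qpow w (l - 1/2) * t) (qpow w (l' - 1/2) * t')"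
  shows "formal_solution q w E (- \<alpha>)
    (\<lambda>n. (\<Sum>k=0..n. qpow w (- (of_nat n * of_nat k)) * (1 / (qpoch q q (n - k) * qpoch q q k))
        * (qpow w (- lam - \<alpha> + l - l') * t / t') ^ k)
      * (- (qpow w (- lam - \<alpha> + l) * t)) ^ n * qpoch (qpow w (lam + \<alpha>)) q n
      * qpow w (- (of_nat n ^ 2 / 2)))
    (\<lambda>n x. qpoch (x / (qpow w (l - 1/2) * t)) q n * inverse x ^ n)"
    (is "formal_solution _ _ _ _ ?a ?\<phi>")
proof -
  let ?s = "qpow w (l - 1/2) * t" and ?r = "qpow w (l' - 1/2) * t'"
  let ?L = "qpow w lam" and ?A = "qpow w \<alpha>"
  define z where "z = ?s / (?r * ?A * ?L)"
  define c where "c n = (\<Sum>k=0..n. z ^ k / (q ^ (n * k) * qpoch q q (n - k) * qpoch q q k))" for n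
  define M where "M n = (- (qpow w (- lam - \<alpha> + l) * t)) ^ n * qpoch (qpow w (lam + \<alpha>)) q n
      * qpow w (- (of_nat n ^ 2 / 2))" for n
  have z: "qpow w (- lam - \<alpha> + l - l') * t / t' = z"
    unfolding z_def qpow_diff[of w _ "1/2"] qpow_diff[of w _ l'] qpow_diff[of w _ \<alpha>]
        qpow_add[of w _ l] qpow_minus[of w lam]
    using t by (simp add: qpow_nonzero field_simps)
  have "qpow w (- (of_nat n * of_nat k)) = 1 / q ^ (n * k)" for n k
    unfolding qpow_minus of_nat_mult[symmetric] qpow_of_nat q(1) by (simp add: inverse_eq_divide)
  then have a: "?a n = M n * c n" for n
    unfolding z M_def c_def by (simp add: mult_ac)
  have M: "M (Suc n) = - ?s / (?A * ?L * q ^ n) * (1 - ?A * ?L * q ^ n) * M n" for n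
  proof -
    \<comment> \<open>The increment -1/2 of the exponent is what turns \<open>qpow w l * t\<close>
      into \<open>?s\<close> in the ratio of consecutive \<open>M\<close>.\<close>
    have exponent: "- ((of_nat (Suc n))\<^sup>2 / 2) = - (of_nat n ^ 2 / 2) - of_nat n - (1/2 :: complex)"
      by (simp add: field_simps power2_eq_square)
    show ?thesis
      unfolding M_def exponent qpow_diff[of w _ "of_nat n"] qpow_of_nat q(1) qpoch_Suc power_Suc
        qpow_add[of w lam] qpow_diff[of w _ "1/2"] qpow_diff[of w _ \<alpha>]
        qpow_add[of w _ l] qpow_minus[of w lam]
      using t q(2) by (simp add: qpow_nonzero field_simps)
  qed
  have "coefficients_vanish ?\<phi> (\<lambda>n x. lhs_term q w E (- \<alpha>) (\<lambda>x. ?a n * ?\<phi> n x) x / x\<^sup>2)"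
    unfolding a lhs_term_def E minus_minus qpow_minus[of w \<alpha>]
  proof (rule coefficients_vanish_stieltjes_wigert)
    show "c 1 * (1 - q) = (1 + ?s / (?r * ?A * ?L) / q) * c 0"
      unfolding c_def z_def[symmetric] by (rule stieltjes_wigert_recurrence[OF q(2) root])
    show "c (Suc (Suc n)) * (1 - q ^ Suc (Suc n)) =
        (1 + 1 / q - 1 / q ^ Suc (Suc n) + ?s / (?r * ?A * ?L) / q ^ (2 * n + 3)) * c (Suc n)
        + c n / q ^ Suc (Suc n)" for n
      unfolding c_def z_def[symmetric] by (rule stieltjes_wigert_recurrence[OF q(2) root])
  qed (use q t M in \<open>simp_all add: qpow_nonzero\<close>)
  then show ?thesis
    unfolding formal_solution_def using polys_in_inverse_x_qpoch[of ?s] t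
    by (simp add: qpow_nonzero)
qed

theorem theorem5p3:
  fixes q w \<alpha> lam :: complex and l t :: "nat \<Rightarrow> complex"
  assumes log_q: "exp w = q"
    and q_nonzero: "q \<noteq> 0"
    and q_not_root_of_unity: "\<forall>n::nat. n > 0 \<longrightarrow> q ^ n \<noteq> 1"
    and t_nonzero: "t 1 \<noteq> 0" "t 2 \<noteq> 0"
  shows
    "(\<forall>(i, i') \<in> {(1, 2), (2, 1)}.
        let a = (\<lambda>n::nat.
              (- qpow w (- lam - \<alpha> + l i - l i') * t i / t i') ^ n
              * (qpow w (- (of_nat n * (of_nat n - 1) / 2)) * qpoch (qpow w (lam + \<alpha>)) q n)
              / qpoch q q n);
            \<phi> = (\<lambda>(n::nat) x. qpoch (x / (qpow w (l i - 1/2) * t i)) q n)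
        in formal_solution q w (confl_lhs q w l \<alpha> lam t) lam a \<phi>
           \<and> (\<forall>n x. a n * \<phi> n x =
                bhs_term [qpow w (lam + \<alpha>), x / (qpow w (l i - 1/2) * t i)] [] q
                  (qpow w (- lam - \<alpha> + l i - l i') * t i / t i') n))
     \<and>
     formal_solution q w (confl_lhs q w l \<alpha> lam t) (- \<alpha>)
       (\<lambda>n. qpow w (1/2) ^ n * qpoch (qpow w (lam + \<alpha>)) q n
            * (\<Sum>k=0..n. (qpow w (l 1) * t 1) ^ k * (qpow w (l 2) * t 2) ^ (n - k)
                          / (qpoch q q k * qpoch q q (n - k))))
       (\<lambda>n x. inverse x ^ n)
     \<and>
     (\<forall>(i, i') \<in> {(1, 2), (2, 1)}.
        let c = (\<lambda>n::nat. \<Sum>k=0..n.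
              qpow w (- (of_nat n * of_nat k)) * (1 / (qpoch q q (n - k) * qpoch q q k))
              * (qpow w (- lam - \<alpha> + l i - l i') * t i / t i') ^ k)
        in formal_solution q w (confl_lhs q w l \<alpha> lam t) (- \<alpha>)
             (\<lambda>n. c n * (- (qpow w (- lam - \<alpha> + l i) * t i)) ^ n
                  * qpoch (qpow w (lam + \<alpha>)) q n * qpow w (- (of_nat n ^ 2 / 2)))
             (\<lambda>n x. qpoch (x / (qpow w (l i - 1/2) * t i)) q n * inverse x ^ n))"
proof -
  let ?s = "\<lambda>i. qpow w (l i - 1/2) * t i"
  let ?op = "\<lambda>i i'. confl_op q (qpow w lam) (qpow w \<alpha>) (?s i) (?s i')"
  \<comment> \<open>By symmetry of the operator in its two base points, either index may play the
    role of \<open>s\<close>, which covers both choices of \<open>(i, i')\<close>.\<close>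
  have E: "confl_lhs q w l \<alpha> lam t = ?op 1 2" "confl_lhs q w l \<alpha> lam t = ?op 2 1"
    using confl_lhs_eq_confl_op[OF log_q] confl_op_commute by simp_all
  note facts = log_q q_nonzero q_not_root_of_unity
  note sol = formal_solution_2phi0[OF facts t_nonzero E(1)]
    formal_solution_2phi0[OF facts t_nonzero(2) t_nonzero(1) E(2)]
    formal_solution_inverse_power[OF facts t_nonzero E(1)]
    formal_solution_stieltjes_wigert[OF facts t_nonzero E(1)]
    formal_solution_stieltjes_wigert[OF facts t_nonzero(2) t_nonzero(1) E(2)]
  \<comment> \<open>Here the minus sign binds to \<open>c\<close> alone, whereas
    \<open>bhs_term_2phi0\<close> negates the whole argument.\<close>
  have bhs: "(- c * u / v) ^ n * (qpow w (- (of_nat n * (of_nat n - 1) / 2)) * qpoch a q n)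
      / qpoch q q n * qpoch b q n = bhs_term [a, b] [] q (c * u / v) n" for a b c u v n
    using bhs_term_2phi0[OF log_q q_nonzero, of "c * u / v"] by simp
  show ?thesis
    unfolding Let_def ball_simps prod.case by (intro conjI allI TrueI sol bhs)
qed

end
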